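(* Let $\mathcal{H}$ be a complex Hilbert space and let $A\in\mathcal{B}(\mathcal{H})$. Then for any $0\le t\le 1$ and for either choice of the sign $\pm$, \[\left\|\sqrt{(1-t)^3}\,\mathfrak{R}A\pm\sqrt{t^3}\,\mathfrak{I}A\right\|\le\frac12\,\omega_t(A)\le\left\|(1-t)^2(\mathfrak{R}A)^2+t^2(\mathfrak{I}A)^2\right\|^{\frac12}.\] In particular, for either choice of sign, \[\frac{1}{\sqrt2}\left\|\mathfrak{R}A\pm\mathfrak{I}A\right\|\le\omega(A)\le\left\|(\mathfrak{R}A)^2+(\mathfrak{I}A)^2\right\|^{\frac12}.\]
   Context: $\mathcal{B}(\mathcal{H})$ is the $C^*$-algebra of bounded linear operators on the complex Hilbert space $\mathcal{H}$, with operator norm $\|\cdot\|$. $\mathfrak{R}A=\frac{A+A^*}{2}$ and $\mathfrak{I}A=\frac{A-A^*}{2\mathrm{i}}$. The numerical radius is $\omega(A)=\sup_{\|x\|=1}|\langle Ax,x\rangle|$. For $0\le t\le 1$, the $t$-weighted numerical radius of $A$ is $\omega_t(A)=\omega\left((1-2t)A^*+A\right)$. *)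

theory Defs
  imports "HOL-Analysis.Analysis"
begin

text \<open>
  Complex Hilbert spaces are built on top of the real normed spaces of the library, with the real
  structure obtained by restriction of scalars. Thus \<^term>\<open>bounded_linear\<close> and
  \<^term>\<open>onorm\<close> apply to operators on them. The inner product is linear in the first argument.
\<close>

class complex_inner = real_normed_vector +
  fixes scaleC :: "complex \<Rightarrow> 'a \<Rightarrow> 'a"  (infixr \<open>*\<^sub>C\<close> 75)
    and cinner :: "'a \<Rightarrow> 'a \<Rightarrow> complex"
  assumes scaleC_add_right: "a *\<^sub>C (x + y) = a *\<^sub>C x + a *\<^sub>C y"
    and scaleC_add_left: "(a + b) *\<^sub>C x = a *\<^sub>C x + b *\<^sub>C x"
    and scaleC_scaleC: "a *\<^sub>C (b *\<^sub>C x) = (a * b) *\<^sub>C x"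
    and scaleC_of_real: "complex_of_real r *\<^sub>C x = r *\<^sub>R x"
    and cinner_commute: "cinner x y = cnj (cinner y x)"
    and cinner_add_left: "cinner (x + y) z = cinner x z + cinner y z"
    and cinner_scaleC_left: "cinner (a *\<^sub>C x) y = a * cinner x y"
    \<comment> \<open>the norm is the one induced by the inner product; since \<^term>\<open>norm\<close> vanishes only
        at 0, this includes positive definiteness\<close>
    and cinner_self: "cinner x x = complex_of_real ((norm x)\<^sup>2)"

class chilbert_space = complex_inner + complete_space

instantiation complex :: chilbert_space
begin

definition scaleC_complex :: "complex \<Rightarrow> complex \<Rightarrow> complex"
  where "scaleC_complex a x = a * x"

definition cinner_complex :: "complex \<Rightarrow> complex \<Rightarrow> complex"
  where "cinner_complex x y = x * cnj y"

instance
proof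
  fix x :: complex
  show "cinner x x = complex_of_real ((norm x)\<^sup>2)"
    unfolding cinner_complex_def by (metis complex_norm_square of_real_power)
qed (simp_all add: scaleC_complex_def cinner_complex_def distrib_left distrib_right
       scaleR_conv_of_real mult.assoc mult.commute)

end

definition bounded_clinear :: "('a::complex_inner \<Rightarrow> 'a) \<Rightarrow> bool"
  where "bounded_clinear A \<longleftrightarrow> bounded_linear A \<and> (\<forall>c x. A (c *\<^sub>C x) = c *\<^sub>C A x)"

text \<open>On a Hilbert space, the adjoint of a bounded operator exists by the Riesz representation
  theorem.\<close>

definition cadjoint :: "('a::complex_inner \<Rightarrow> 'a) \<Rightarrow> 'a \<Rightarrow> 'a"
  where "cadjoint A = (THE B. bounded_clinear B \<and> (\<forall>x y. cinner (A x) y = cinner x (B y)))"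

definition re_part :: "('a::complex_inner \<Rightarrow> 'a) \<Rightarrow> 'a \<Rightarrow> 'a"
  where "re_part A = (\<lambda>x. (1 / 2) *\<^sub>C (A x + cadjoint A x))"

definition im_part :: "('a::complex_inner \<Rightarrow> 'a) \<Rightarrow> 'a \<Rightarrow> 'a"
  where "im_part A = (\<lambda>x. (1 / (2 * \<i>)) *\<^sub>C (A x - cadjoint A x))"

text \<open>The supremum is that of a set of nonnegative reals. Inserting 0 has no effect except on
  the zero space, which has no unit vectors; there it gives the value 0.\<close>

definition num_radius :: "('a::complex_inner \<Rightarrow> 'a) \<Rightarrow> real"
  where "num_radius A = Sup (insert 0 {cmod (cinner (A x) x) | x. norm x = 1})"

definition weighted_num_radius :: "real \<Rightarrow> ('a::complex_inner \<Rightarrow> 'a) \<Rightarrow> real"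
  where "weighted_num_radius t A = num_radius (\<lambda>x. (1 - 2 * t) *\<^sub>R cadjoint A x + A x)"

end

theory Submission imports Defs begin

text \<open>
  Write \<open>r = \<langle>\<Re>A x, x\<rangle>\<close> and \<open>s = \<langle>\<Im>A x, x\<rangle>\<close> for a unit vector \<open>x\<close>. Both are real, and
  \<open>(1 - 2t)A\<^sup>* + A = 2((1 - t)\<Re>A + \<i>t\<Im>A)\<close>, so \<open>\<omega>\<^sub>t(A)/2\<close> is the supremum of
  \<open>((1 - t)\<^sup>2r\<^sup>2 + t\<^sup>2s\<^sup>2)\<^sup>1\<^sup>/\<^sup>2\<close>. The upper bound holds because \<open>r\<^sup>2 \<le> \<parallel>\<Re>A x\<parallel>\<^sup>2 = \<langle>(\<Re>A)\<^sup>2x, x\<rangle>\<close>,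
  and likewise for \<open>s\<close>. For the lower bound, the norm of a self-adjoint operator is the supremum of
  the modulus of its quadratic form, and by the Cauchy-Schwarz inequality in the plane, with weights
  \<open>(\<surd>(1 - t), \<plusminus>\<surd>t)\<close>, one has
  \<open>\<bar>\<surd>(1 - t)(1 - t)r \<plusminus> \<surd>t t s\<bar> \<le> ((1 - t)\<^sup>2r\<^sup>2 + t\<^sup>2s\<^sup>2)\<^sup>1\<^sup>/\<^sup>2\<close>. The remaining bounds are twice
  the case \<open>t = 1/2\<close>.
\<close>

subsection \<open>Complex inner products\<close>

lemma scaleR_eq_scaleC: "r *\<^sub>R x = complex_of_real r *\<^sub>C (x::'a::complex_inner)"
  by (simp add: scaleC_of_real)

lemma cinner_scaleR_left: "cinner (r *\<^sub>R x) y = of_real r * cinner x y"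
  by (simp add: scaleR_eq_scaleC cinner_scaleC_left)

lemma cinner_minus_left: "cinner (- x) y = - cinner x y"
  using cinner_scaleR_left[of "-1" x y] by simp

lemma cinner_diff_left: "cinner (x - y) z = cinner x z - cinner y z"
  using cinner_add_left[of x "- y" z] by (simp add: cinner_minus_left)

lemma cinner_add_right: "cinner x (y + z) = cinner x y + cinner x z"
  by (metis cinner_add_left cinner_commute complex_cnj_add)

lemma cinner_minus_right: "cinner x (- y) = - cinner x y"
  by (metis cinner_minus_left cinner_commute complex_cnj_minus)

lemma cinner_diff_right: "cinner x (y - z) = cinner x y - cinner x z"
  by (metis cinner_diff_left cinner_commute complex_cnj_diff)

lemma cinner_scaleC_right: "cinner x (a *\<^sub>C y) = cnj a * cinner x y"
  by (metis cinner_scaleC_left cinner_commute complex_cnj_mult)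

lemma cinner_scaleR_right: "cinner x (r *\<^sub>R y) = of_real r * cinner x y"
  by (simp add: scaleR_eq_scaleC cinner_scaleC_right)

lemma Re_cinner_commute: "Re (cinner x y) = Re (cinner y x)"
  by (subst cinner_commute) simp

lemmas cinner_simps =
  cinner_add_left cinner_add_right cinner_diff_left cinner_diff_right
  cinner_scaleR_left cinner_scaleR_right cinner_scaleC_left cinner_scaleC_right

lemma cinner_right_ext:
  fixes y z :: "'a::complex_inner"
  assumes "\<And>x. cinner x y = cinner x z"
  shows "y = z"
proof -
  have "cinner (y - z) (y - z) = 0"
    using assms[of "y - z"] by (simp add: cinner_diff_right)
  then show ?thesis
    by (simp add: cinner_self)
qed

lemma norm_add_power2:
  fixes x y :: "'a::complex_inner"
  shows "(norm (x + y))\<^sup>2 = (norm x)\<^sup>2 + 2 * Re (cinner x y) + (norm y)\<^sup>2"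
proof -
  have sq: "(norm z)\<^sup>2 = Re (cinner z z)" for z :: 'a
    by (simp add: cinner_self del: of_real_power)
  show ?thesis
    unfolding sq by (simp add: cinner_add_left cinner_add_right Re_cinner_commute[of y x])
qed

lemma norm_diff_power2:
  fixes x y :: "'a::complex_inner"
  shows "(norm (x - y))\<^sup>2 = (norm x)\<^sup>2 - 2 * Re (cinner x y) + (norm y)\<^sup>2"
  using norm_add_power2[of x "- y"] by (simp add: cinner_minus_right)

text \<open>The norm axioms give homogeneity for real scalars only; here the two slots of
  \<open>cinner_self\<close> contribute \<open>a\<close> and \<open>cnj a\<close>.\<close>

lemma norm_scaleC:
  fixes x :: "'a::complex_inner"
  shows "norm (a *\<^sub>C x) = cmod a * norm x"
proof -
  have "complex_of_real ((norm (a *\<^sub>C x))\<^sup>2) = a * cnj a * complex_of_real ((norm x)\<^sup>2)"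
    unfolding cinner_self[symmetric] by (simp add: cinner_scaleC_left cinner_scaleC_right)
  also have "\<dots> = complex_of_real ((cmod a * norm x)\<^sup>2)"
    by (simp add: complex_norm_square[symmetric] power_mult_distrib del: of_real_power)
  finally show ?thesis
    unfolding of_real_eq_iff by (simp add: power2_eq_iff_nonneg)
qed

text \<open>The usual derivation reversed: \<open>norm\<close> already satisfies the triangle
  inequality, and expanding its square isolates the real part.\<close>

lemma Re_cinner_le_norm:
  fixes x y :: "'a::complex_inner"
  shows "Re (cinner x y) \<le> norm x * norm y"
proof -
  have "(norm (x + y))\<^sup>2 \<le> (norm x + norm y)\<^sup>2"
    by (intro power_mono norm_triangle_ineq norm_ge_zero)
  then show ?thesis
    by (simp add: norm_add_power2 power2_sum)
qed

text \<open>Multiplying \<open>x\<close> by a unimodular scalar makes the inner product real and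
  nonnegative, which reduces the claim to real parts.\<close>

lemma cmod_cinner_le_norm:
  fixes x y :: "'a::complex_inner"
  shows "cmod (cinner x y) \<le> norm x * norm y"
proof (cases "cinner x y = 0")
  case False
  let ?a = "cinner x y"
  have "cnj (sgn ?a) * ?a = complex_of_real (cmod ?a)"
    using False by (simp add: sgn_div_norm scaleR_conv_of_real complex_norm_square[symmetric]
        mult.commute[of "cnj _"] mult.assoc power2_eq_square field_simps)
  then have "cmod ?a = Re (cinner (cnj (sgn ?a) *\<^sub>C x) y)"
    by (simp add: cinner_scaleC_left)
  also have "\<dots> \<le> norm (cnj (sgn ?a) *\<^sub>C x) * norm y"
    by (rule Re_cinner_le_norm)
  also have "\<dots> = norm x * norm y"
    using False by (simp add: norm_scaleC norm_sgn)
  finally show ?thesis .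
qed simp

lemma bounded_linear_scaleC: "bounded_linear (\<lambda>x::'a::complex_inner. a *\<^sub>C x)"
proof (rule bounded_linear_intro)
  show "a *\<^sub>C (r *\<^sub>R x) = r *\<^sub>R (a *\<^sub>C x)" for r and x :: 'a
    by (simp add: scaleR_eq_scaleC scaleC_scaleC mult.commute)
  show "norm (a *\<^sub>C x) \<le> norm x * cmod a" for x :: 'a
    by (simp add: norm_scaleC)
qed (rule scaleC_add_right)

lemma bounded_linear_cinner_left: "bounded_linear (\<lambda>x::'a::complex_inner. cinner x y)"
  by (rule bounded_linear_intro[where K = "norm y"])
    (simp_all add: cinner_add_left cinner_scaleR_left scaleR_conv_of_real cmod_cinner_le_norm)

subsection \<open>The Riesz representation theorem and adjoints\<close>

text \<open>The representing vector minimises \<open>\<parallel>x\<parallel>\<^sup>2 - 2 f(x)\<close>; by the parallelogram law, every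
  minimising sequence is Cauchy.\<close>

lemma riesz_representation_real:
  fixes f :: "'a::chilbert_space \<Rightarrow> real"
  assumes "bounded_linear f"
  obtains u where "\<And>y. f y = Re (cinner y u)"
proof -
  interpret f: bounded_linear f by fact
  define J where "J x = (norm x)\<^sup>2 - 2 * f x" for x
  define m where "m = Inf (range J)"
  obtain K where K: "\<And>x. norm (f x) \<le> norm x * K"
    using f.bounded by blast
  have "- K\<^sup>2 \<le> J x" for x
  proof -
    have "0 \<le> (norm x - K)\<^sup>2" by simp
    moreover have "f x \<le> norm x * K" using K[of x] by simp
    ultimately show ?thesis by (simp add: J_def power2_diff)
  qed
  then have bdd: "bdd_below (range J)"
    by (meson bdd_belowI2)
  have m_le: "m \<le> J x" for x
    unfolding m_def by (rule cINF_lower[OF bdd]) simp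
  have "\<exists>x. J x < m + 1 / real (Suc n)" for n
  proof -
    have "Inf (range J) < m + 1 / real (Suc n)"
      by (simp add: m_def)
    from cInf_lessD[OF _ this] show ?thesis by auto
  qed
  then obtain X where X: "\<And>n. J (X n) < m + 1 / real (Suc n)"
    by metis
  \<comment> \<open>In 2 \<open>J x\<close> + 2 \<open>J y\<close> - 4 \<open>J\<close>(midpoint)
    the linear terms cancel and the parallelogram law leaves the squared distance; at the midpoint
    \<open>J\<close> is at least \<open>m\<close>.\<close>
  have par: "(norm (x - y))\<^sup>2 \<le> 2 * (J x - m) + 2 * (J y - m)" for x y
  proof -
    have "4 * J ((1/2) *\<^sub>R (x + y)) = (norm (x + y))\<^sup>2 - 4 * (f x + f y)"
      unfolding J_def norm_scaleR f.scaleR f.add by (simp add: power_mult_distrib power_divide add_divide_distrib)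
    with m_le[of "(1/2) *\<^sub>R (x + y)"] show ?thesis
      by (simp add: J_def norm_add_power2 norm_diff_power2)
  qed
  have "Cauchy X"
  proof (rule CauchyI)
    fix e :: real assume "0 < e"
    then obtain N where N: "1 / real (Suc N) < e\<^sup>2 / 4"
      using nat_approx_posE[of "e\<^sup>2 / 4"] by auto
    have small: "J (X n) - m < e\<^sup>2 / 4" if "N \<le> n" for n
    proof -
      have "1 / real (Suc n) \<le> 1 / real (Suc N)"
        using that by (simp add: frac_le)
      with X[of n] N show ?thesis by simp
    qed
    have "norm (X k - X n) < e" if "N \<le> k" "N \<le> n" for k n
    proof (rule power_less_imp_less_base)
      show "(norm (X k - X n))\<^sup>2 < e\<^sup>2"
        using par[of "X k" "X n"] small[OF that(1)] small[OF that(2)] by simp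
    qed (use \<open>0 < e\<close> in simp)
    then show "\<exists>M. \<forall>k\<ge>M. \<forall>n\<ge>M. norm (X k - X n) < e"
      by blast
  qed
  then obtain u where u: "X \<longlonglongrightarrow> u"
    using Cauchy_convergent_iff convergent_def by blast
  have "(\<lambda>n. J (X n)) \<longlonglongrightarrow> J u"
    unfolding J_def by (intro tendsto_intros f.tendsto u)
  moreover have "(\<lambda>n. m + 1 / real (Suc n)) \<longlonglongrightarrow> m + 0"
    by (intro tendsto_add tendsto_const LIMSEQ_Suc[OF lim_1_over_n])
  ultimately have "J u \<le> m + 0"
    using X by (intro LIMSEQ_le) (auto intro: less_imp_le)
  then have min: "J u \<le> J x" for x
    using m_le[of x] by simp
  have "f y = Re (cinner y u)" for y
  proof (rule ccontr)
    \<comment> \<open>First variation at the minimiser: \<open>J (u + s *\<^sub>R y) - J u\<close>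
      is 2sc + s^2 |y|^2. A small \<open>s\<close> of sign opposite to \<open>c\<close> makes this
      negative; the choice is \<open>s = - c / N\<close>, where the added 1 in \<open>N\<close>
      avoids division by zero at \<open>y = 0\<close>.\<close>
    define c where "c = Re (cinner u y) - f y"
    define N where "N = (norm y)\<^sup>2 + 1"
    assume "f y \<noteq> Re (cinner y u)"
    then have "c \<noteq> 0"
      by (simp add: c_def Re_cinner_commute[of u y])
    have "N > 0"
      by (simp add: N_def add_nonneg_pos)
    have "0 \<le> 2 * s * c + s\<^sup>2 * (norm y)\<^sup>2" for s
      using min[of "u + s *\<^sub>R y"]
      by (simp add: J_def norm_add_power2 cinner_scaleR_right f.add f.scaleR c_def
          power_mult_distrib algebra_simps)
    from this[of "- c / N"] have "0 \<le> (2 * (- c / N) * c + (- c / N)\<^sup>2 * (N - 1)) * N\<^sup>2"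
      by (simp add: N_def)
    also have "\<dots> = - (c\<^sup>2 * (N + 1))"
      using \<open>N > 0\<close> by (simp add: field_simps power2_eq_square)
    finally show False
      using \<open>c \<noteq> 0\<close> \<open>N > 0\<close> by (simp add: mult_le_0_iff)
  qed
  then show thesis by (rule that)
qed

text \<open>A complex-linear functional is determined by its real part, since its imaginary part at
  \<open>y\<close> is minus its real part at \<open>\<i> *\<^sub>C y\<close>.\<close>

lemma riesz_representation:
  fixes \<phi> :: "'a::chilbert_space \<Rightarrow> complex"
  assumes "bounded_linear \<phi>" and "\<And>c x. \<phi> (c *\<^sub>C x) = c * \<phi> x"
  obtains u where "\<And>y. \<phi> y = cinner y u"
proof -
  have "bounded_linear (\<lambda>x. Re (\<phi> x))"
    using assms(1) by (rule bounded_linear_compose[OF bounded_linear_Re])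
  then obtain u where u: "\<And>y. Re (\<phi> y) = Re (cinner y u)"
    using riesz_representation_real by blast
  have "Im (\<phi> y) = Im (cinner y u)" for y
    using u[of "\<i> *\<^sub>C y"] by (simp add: assms(2) cinner_scaleC_left)
  with u show thesis
    by (intro that) (simp add: complex_eq_iff)
qed

text \<open>Riesz is applied to \<open>\<lambda>x. cinner (A x) y\<close> for each fixed
  \<open>y\<close>. Linearity of \<open>B\<close> follows by testing against all vectors, and its
  bound by dividing |By|^2 = <A(By), y> \<le> K |By| |y| by |By|.\<close>

lemma bounded_clinear_adjoint_exists:
  fixes A :: "'a::chilbert_space \<Rightarrow> 'a"
  assumes "bounded_clinear A"
  obtains B where "bounded_clinear B" and "\<And>x y. cinner (A x) y = cinner x (B y)"
proof -
  have bl: "bounded_linear A" and sc: "\<And>c x. A (c *\<^sub>C x) = c *\<^sub>C A x"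
    using assms by (auto simp: bounded_clinear_def)
  obtain K where K: "\<And>x. norm (A x) \<le> norm x * K" and "0 \<le> K"
    using bounded_linear.nonneg_bounded[OF bl] by blast
  have "\<exists>z. \<forall>x. cinner (A x) y = cinner x z" for y
    by (rule riesz_representation[of "\<lambda>x. cinner (A x) y"])
      (auto simp: sc cinner_scaleC_left intro: bounded_linear_compose[OF bounded_linear_cinner_left bl])
  then obtain B where B: "\<And>x y. cinner (A x) y = cinner x (B y)"
    by metis
  have BC: "B (c *\<^sub>C y) = c *\<^sub>C B y" for c y
    by (rule cinner_right_ext) (simp add: B[symmetric] cinner_scaleC_right)
  have "bounded_linear B"
  proof (rule bounded_linear_intro)
    show "B (x + y) = B x + B y" for x y
      by (rule cinner_right_ext) (simp add: B[symmetric] cinner_add_right)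
    show "B (r *\<^sub>R y) = r *\<^sub>R B y" for r y
      by (simp add: scaleR_eq_scaleC BC)
    show "norm (B y) \<le> norm y * K" for y
    proof (cases "B y = 0")
      case False
      have "complex_of_real ((norm (B y))\<^sup>2) = cinner (A (B y)) y"
        by (simp add: B cinner_self)
      then have "(norm (B y))\<^sup>2 = cmod (cinner (A (B y)) y)"
        by (metis norm_of_real abs_of_nonneg zero_le_power2)
      also have "\<dots> \<le> norm (A (B y)) * norm y"
        by (rule cmod_cinner_le_norm)
      also have "\<dots> \<le> norm (B y) * K * norm y"
        by (intro mult_right_mono K) simp
      finally show ?thesis
        using False by (simp add: power2_eq_square mult_ac)
    qed (use \<open>0 \<le> K\<close> in simp)
  qed
  with BC B show thesis
    by (intro that) (auto simp: bounded_clinear_def)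
qed

text \<open>Existence together with uniqueness, the latter by \<open>cinner_right_ext\<close>, makes
  the \<open>THE\<close> in \<open>cadjoint\<close> denote the actual adjoint.\<close>

lemma
  fixes A :: "'a::chilbert_space \<Rightarrow> 'a"
  assumes "bounded_clinear A"
  shows bounded_clinear_cadjoint: "bounded_clinear (cadjoint A)"
    and cinner_cadjoint: "cinner (A x) y = cinner x (cadjoint A y)"
proof -
  obtain B where B: "bounded_clinear B" "\<And>x y. cinner (A x) y = cinner x (B y)"
    using bounded_clinear_adjoint_exists[OF assms] by blast
  have "cadjoint A = B"
    unfolding cadjoint_def
  proof (rule the_equality)
    fix C assume "bounded_clinear C \<and> (\<forall>x y. cinner (A x) y = cinner x (C y))"
    then show "C = B"
      by (metis B(2) cinner_right_ext ext)
  qed (use B in simp)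
  with B show "bounded_clinear (cadjoint A)" "cinner (A x) y = cinner x (cadjoint A y)"
    by simp_all
qed

subsection \<open>Numerical radius and self-adjoint operators\<close>

text \<open>\<open>Sup\<close> on the reals is meaningful only for sets bounded above;
  Cauchy-Schwarz supplies the bound \<open>onorm A\<close>.\<close>

lemma cinner_le_num_radius:
  fixes A :: "'a::complex_inner \<Rightarrow> 'a"
  assumes "bounded_linear A" and "norm x = 1"
  shows "cmod (cinner (A x) x) \<le> num_radius A"
  unfolding num_radius_def
proof (rule cSup_upper)
  show "bdd_above (insert 0 {cmod (cinner (A x) x) |x. norm x = 1})"
  proof (rule bdd_aboveI)
    fix b assume "b \<in> insert 0 {cmod (cinner (A x) x) |x. norm x = 1}"
    then show "b \<le> onorm A"
      using onorm[OF assms(1)] cmod_cinner_le_norm[of "A _"] onorm_pos_le[OF assms(1)]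
      by (fastforce intro: order_trans)
  qed
qed (use assms(2) in auto)

lemma num_radius_le:
  fixes A :: "'a::complex_inner \<Rightarrow> 'a"
  assumes "0 \<le> c" and "\<And>x. norm x = 1 \<Longrightarrow> cmod (cinner (A x) x) \<le> c"
  shows "num_radius A \<le> c"
  unfolding num_radius_def using assms by (intro cSup_least) auto

lemma num_radius_nonneg:
  fixes A :: "'a::complex_inner \<Rightarrow> 'a"
  assumes "bounded_linear A"
  shows "0 \<le> num_radius A"
proof (cases "\<exists>x::'a. norm x = 1")
  case True
  then show ?thesis
    using cinner_le_num_radius[OF assms] norm_ge_zero order_trans by blast
next
  case False
  then show ?thesis
    by (simp add: num_radius_def)
qed

text \<open>The bound on the form extends to all vectors by homogeneity. Self-adjointness makes both
  cross terms equal, so 4 Re <Tx, y> is the form at \<open>x + y\<close> minus the form at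
  \<open>x - y\<close>; the parallelogram law adds up the two bounds.\<close>

lemma onorm_selfadjoint_le:
  fixes T :: "'a::complex_inner \<Rightarrow> 'a"
  assumes "bounded_linear T"
    and sa: "\<And>x y. cinner (T x) y = cinner x (T y)"
    and "0 \<le> w"
    and w: "\<And>x. norm x = 1 \<Longrightarrow> cmod (cinner (T x) x) \<le> w"
  shows "onorm T \<le> w"
proof (rule onorm_bound)
  interpret T: bounded_linear T by fact
  have q: "\<bar>Re (cinner (T x) x)\<bar> \<le> w * (norm x)\<^sup>2" for x
  proof (cases "x = 0")
    case False
    define y where "y = (1 / norm x) *\<^sub>R x"
    have "x = norm x *\<^sub>R y" "norm y = 1"
      using False by (simp_all add: y_def)
    have "Re (cinner (T (c *\<^sub>R y)) (c *\<^sub>R y)) = c\<^sup>2 * Re (cinner (T y) y)" for c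
      by (simp add: T.scaleR cinner_simps power2_eq_square)
    then have "Re (cinner (T x) x) = (norm x)\<^sup>2 * Re (cinner (T y) y)"
      using \<open>x = norm x *\<^sub>R y\<close> by metis
    moreover have "\<bar>Re (cinner (T y) y)\<bar> \<le> w"
      using w[OF \<open>norm y = 1\<close>] abs_Re_le_cmod order_trans by blast
    ultimately show ?thesis
      by (simp add: abs_mult mult.commute mult_right_mono)
  qed (simp add: T.zero cinner_self)
  text \<open>Polarisation, applied with \<open>y\<close> the multiple of \<open>T x\<close> of norm \<open>\<parallel>x\<parallel>\<close>.\<close>
  have pol: "2 * Re (cinner (T x) y) \<le> w * ((norm x)\<^sup>2 + (norm y)\<^sup>2)" for x y
  proof -
    have "Re (cinner (T y) x) = Re (cinner (T x) y)"
      by (simp add: sa Re_cinner_commute[of y])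
    then have "4 * Re (cinner (T x) y) =
        Re (cinner (T (x + y)) (x + y)) - Re (cinner (T (x - y)) (x - y))"
      by (simp add: T.add T.diff cinner_simps)
    also have "\<dots> \<le> w * (norm (x + y))\<^sup>2 + w * (norm (x - y))\<^sup>2"
      using q[of "x + y"] q[of "x - y"] by linarith
    also have "\<dots> = 2 * (w * ((norm x)\<^sup>2 + (norm y)\<^sup>2))"
      by (simp add: norm_add_power2 norm_diff_power2 algebra_simps)
    finally show ?thesis by simp
  qed
  show "norm (T x) \<le> w * norm x" for x
  proof (cases "T x = 0 \<or> x = 0")
    case False
    define y where "y = (norm x / norm (T x)) *\<^sub>R T x"
    have "norm y = norm x" and "Re (cinner (T x) y) = norm x * norm (T x)"
      using False by (simp_all add: y_def cinner_scaleR_right cinner_self power2_eq_square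
          flip: of_real_mult of_real_divide)
    with pol[of x y] have "norm x * norm (T x) \<le> norm x * (w * norm x)"
      by (simp add: power2_eq_square algebra_simps)
    with False show ?thesis by simp
  qed (use \<open>0 \<le> w\<close> in \<open>auto simp: T.zero\<close>)
qed fact

subsection \<open>Cartesian decomposition\<close>

context
  fixes A :: "'a::chilbert_space \<Rightarrow> 'a"
  assumes A: "bounded_clinear A"
begin

lemma bounded_linear_cadjoint: "bounded_linear (cadjoint A)"
  using bounded_clinear_cadjoint[OF A] by (simp add: bounded_clinear_def)

lemma cinner_cadjoint_left: "cinner (cadjoint A x) y = cinner x (A y)"
  by (metis A cinner_cadjoint cinner_commute)

lemma bounded_linear_re_part: "bounded_linear (re_part A)"
  unfolding re_part_def using A bounded_linear_cadjoint
  by (intro bounded_linear_compose[OF bounded_linear_scaleC] bounded_linear_add)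
    (auto simp: bounded_clinear_def)

lemma bounded_linear_im_part: "bounded_linear (im_part A)"
  unfolding im_part_def using A bounded_linear_cadjoint
  by (intro bounded_linear_compose[OF bounded_linear_scaleC] bounded_linear_sub)
    (auto simp: bounded_clinear_def)

lemma re_part_selfadjoint: "cinner (re_part A x) y = cinner x (re_part A y)"
  by (simp add: re_part_def cinner_simps cinner_cadjoint[OF A] cinner_cadjoint_left)

lemma im_part_selfadjoint: "cinner (im_part A x) y = cinner x (im_part A y)"
  by (simp add: im_part_def cinner_simps cinner_cadjoint[OF A] cinner_cadjoint_left field_simps)

lemma cinner_cadjoint_self: "cinner (cadjoint A x) x = cnj (cinner (A x) x)"
  by (simp add: cinner_cadjoint_left cinner_commute[of x])

lemma cinner_re_part: "cinner (re_part A x) x = complex_of_real (Re (cinner (A x) x))"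
  by (simp add: re_part_def cinner_simps cinner_cadjoint_self complex_eq_iff)

lemma cinner_im_part: "cinner (im_part A x) x = complex_of_real (Im (cinner (A x) x))"
  by (simp add: im_part_def cinner_simps cinner_cadjoint_self complex_eq_iff)

lemma bounded_linear_weighted: "bounded_linear (\<lambda>x. (1 - 2 * t) *\<^sub>R cadjoint A x + A x)"
  using A bounded_linear_cadjoint
  by (intro bounded_linear_add bounded_linear_compose[OF bounded_linear_scaleR_right])
    (auto simp: bounded_clinear_def)

text \<open>With z = <Ax, x>, the adjoint contributes the conjugate of z, and (1 - 2t) cnj z + z =
  2((1 - t) Re z + i t Im z).\<close>

lemma cmod_cinner_weighted:
  "cmod (cinner ((1 - 2 * t) *\<^sub>R cadjoint A x + A x) x) =
    2 * sqrt (((1 - t) * Re (cinner (A x) x))\<^sup>2 + (t * Im (cinner (A x) x))\<^sup>2)"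
proof -
  have "cinner ((1 - 2 * t) *\<^sub>R cadjoint A x + A x) x =
      2 * Complex ((1 - t) * Re (cinner (A x) x)) (t * Im (cinner (A x) x))"
    by (simp add: cinner_simps cinner_cadjoint_self complex_eq_iff algebra_simps)
  then show ?thesis
    by (simp add: norm_mult complex_norm)
qed

text \<open>The parameter \<open>\<sigma>\<close> is 1 or -1, so that both signs are treated at
  once.\<close>

lemma onorm_parts_le_weighted:
  assumes t: "0 \<le> t" "t \<le> 1" and "\<sigma>\<^sup>2 = 1"
  shows "onorm (\<lambda>x. sqrt ((1 - t) ^ 3) *\<^sub>R re_part A x + (\<sigma> * sqrt (t ^ 3)) *\<^sub>R im_part A x)
    \<le> 1 / 2 * weighted_num_radius t A" (is "onorm ?T \<le> _")
proof (rule onorm_selfadjoint_le)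
  show "bounded_linear ?T"
    by (intro bounded_linear_add bounded_linear_compose[OF bounded_linear_scaleR_right]
        bounded_linear_re_part bounded_linear_im_part)
  show "cinner (?T x) y = cinner x (?T y)" for x y
    by (simp add: cinner_simps re_part_selfadjoint im_part_selfadjoint)
  show "0 \<le> 1 / 2 * weighted_num_radius t A"
    using num_radius_nonneg[OF bounded_linear_weighted] by (simp add: weighted_num_radius_def)
  fix x :: 'a assume x: "norm x = 1"
  define r s where "r = (1 - t) * Re (cinner (A x) x)" and "s = t * Im (cinner (A x) x)"
  \<comment> \<open>One factor \<open>a\<close> goes into \<open>r\<close> or \<open>s\<close>; the
    remaining square roots form a unit vector in the plane.\<close>
  have cube: "sqrt (a ^ 3) = sqrt a * a" if "0 \<le> a" for a :: real
    using that by (simp add: power3_eq_cube real_sqrt_mult)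
  have "cinner (?T x) x = complex_of_real (sqrt (1 - t) * r + \<sigma> * sqrt t * s)"
    using t by (simp add: cinner_simps cinner_re_part cinner_im_part cube r_def s_def)
  then have "cmod (cinner (?T x) x) = \<bar>sqrt (1 - t) * r + \<sigma> * sqrt t * s\<bar>"
    by (simp only: norm_of_real)
  also have "\<dots> \<le> sqrt (r\<^sup>2 + s\<^sup>2)"
  proof (rule real_le_rsqrt, unfold power2_abs)
    \<comment> \<open>Lagrange's identity: the second square is the exact slack in the planar
      Cauchy-Schwarz inequality.\<close>
    have "(sqrt (1 - t) * r + \<sigma> * sqrt t * s)\<^sup>2 + (\<sigma> * sqrt t * r - sqrt (1 - t) * s)\<^sup>2
        = ((sqrt (1 - t))\<^sup>2 + \<sigma>\<^sup>2 * (sqrt t)\<^sup>2) * (r\<^sup>2 + s\<^sup>2)"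
      by (simp add: power2_eq_square algebra_simps)
    also have "\<dots> = r\<^sup>2 + s\<^sup>2"
      using t \<open>\<sigma>\<^sup>2 = 1\<close> by simp
    finally show "(sqrt (1 - t) * r + \<sigma> * sqrt t * s)\<^sup>2 \<le> r\<^sup>2 + s\<^sup>2"
      by (smt (verit) zero_le_power2)
  qed
  also have "\<dots> = 1 / 2 * cmod (cinner ((1 - 2 * t) *\<^sub>R cadjoint A x + A x) x)"
    unfolding cmod_cinner_weighted r_def s_def by simp
  also have "\<dots> \<le> 1 / 2 * weighted_num_radius t A"
    using cinner_le_num_radius[OF bounded_linear_weighted x, of t]
    by (simp add: weighted_num_radius_def)
  finally show "cmod (cinner (?T x) x) \<le> 1 / 2 * weighted_num_radius t A" .
qed

lemma bounded_linear_sum_squares: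
  "bounded_linear (\<lambda>x. a *\<^sub>R re_part A (re_part A x) + b *\<^sub>R im_part A (im_part A x))"
  by (intro bounded_linear_add bounded_linear_compose[OF bounded_linear_scaleR_right]
      bounded_linear_compose[OF bounded_linear_re_part bounded_linear_re_part]
      bounded_linear_compose[OF bounded_linear_im_part bounded_linear_im_part])

lemma weighted_le_onorm_squares:
  "1 / 2 * weighted_num_radius t A
    \<le> sqrt (onorm (\<lambda>x. (1 - t)\<^sup>2 *\<^sub>R re_part A (re_part A x) + t\<^sup>2 *\<^sub>R im_part A (im_part A x)))"
  (is "_ \<le> sqrt (onorm ?S)")
proof -
  have S: "bounded_linear ?S" by (rule bounded_linear_sum_squares)
  have "weighted_num_radius t A \<le> 2 * sqrt (onorm ?S)"
    unfolding weighted_num_radius_def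
  proof (rule num_radius_le)
    show "0 \<le> 2 * sqrt (onorm ?S)"
      using onorm_pos_le[OF S] by simp
    fix x :: 'a assume x: "norm x = 1"
    have "\<bar>Re (cinner (A x) x)\<bar> \<le> norm (re_part A x)" "\<bar>Im (cinner (A x) x)\<bar> \<le> norm (im_part A x)"
      using cmod_cinner_le_norm[of "re_part A x" x] cmod_cinner_le_norm[of "im_part A x" x] x
      by (simp_all add: cinner_re_part cinner_im_part)
    then have "(Re (cinner (A x) x))\<^sup>2 \<le> (norm (re_part A x))\<^sup>2"
      "(Im (cinner (A x) x))\<^sup>2 \<le> (norm (im_part A x))\<^sup>2"
      by (simp_all add: abs_le_square_iff[symmetric])
    then have "((1 - t) * Re (cinner (A x) x))\<^sup>2 + (t * Im (cinner (A x) x))\<^sup>2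
        \<le> (1 - t)\<^sup>2 * (norm (re_part A x))\<^sup>2 + t\<^sup>2 * (norm (im_part A x))\<^sup>2"
      unfolding power_mult_distrib by (intro add_mono mult_left_mono) simp_all
    \<comment> \<open>Self-adjointness moves one factor across, turning <R(Rx), x> into |Rx|^2 for
      each part R.\<close>
    also have "\<dots> = Re (cinner (?S x) x)"
      by (simp add: cinner_simps re_part_selfadjoint[of "re_part A x" x]
          im_part_selfadjoint[of "im_part A x" x] cinner_self flip: of_real_power)
    also have "\<dots> \<le> norm (?S x) * norm x"
      by (rule Re_cinner_le_norm)
    also have "\<dots> \<le> onorm ?S"
      using onorm[OF S, of x] x by simp
    finally show "cmod (cinner ((1 - 2 * t) *\<^sub>R cadjoint A x + A x) x) \<le> 2 * sqrt (onorm ?S)"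
      unfolding cmod_cinner_weighted by simp
  qed
  then show ?thesis by simp
qed

end

theorem theorem2p4:
  fixes A :: "'a::chilbert_space \<Rightarrow> 'a"
  assumes "bounded_clinear A"
  shows "(\<forall>t::real. 0 \<le> t \<and> t \<le> 1 \<longrightarrow>
            onorm (\<lambda>x. sqrt ((1 - t) ^ 3) *\<^sub>R re_part A x + sqrt (t ^ 3) *\<^sub>R im_part A x)
              \<le> 1 / 2 * weighted_num_radius t A
          \<and> onorm (\<lambda>x. sqrt ((1 - t) ^ 3) *\<^sub>R re_part A x - sqrt (t ^ 3) *\<^sub>R im_part A x)
              \<le> 1 / 2 * weighted_num_radius t A
          \<and> 1 / 2 * weighted_num_radius t A
              \<le> sqrt (onorm (\<lambda>x. (1 - t)\<^sup>2 *\<^sub>R re_part A (re_part A x)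
                                  + t\<^sup>2 *\<^sub>R im_part A (im_part A x))))
       \<and> 1 / sqrt 2 * onorm (\<lambda>x. re_part A x + im_part A x) \<le> num_radius A
       \<and> 1 / sqrt 2 * onorm (\<lambda>x. re_part A x - im_part A x) \<le> num_radius A
       \<and> num_radius A \<le> sqrt (onorm (\<lambda>x. re_part A (re_part A x) + im_part A (im_part A x)))"
proof -
  note R = bounded_linear_re_part[OF assms] and I = bounded_linear_im_part[OF assms]
  have plus: "onorm (\<lambda>x. sqrt ((1 - t) ^ 3) *\<^sub>R re_part A x + sqrt (t ^ 3) *\<^sub>R im_part A x)
      \<le> 1 / 2 * weighted_num_radius t A"
    and minus: "onorm (\<lambda>x. sqrt ((1 - t) ^ 3) *\<^sub>R re_part A x - sqrt (t ^ 3) *\<^sub>R im_part A x)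
      \<le> 1 / 2 * weighted_num_radius t A" if "0 \<le> t" "t \<le> 1" for t
    using onorm_parts_le_weighted[OF assms that, of 1] onorm_parts_le_weighted[OF assms that, of "-1"]
    by simp_all
  \<comment> \<open>At t = 1/2 the coefficient of the adjoint vanishes.\<close>
  have half: "weighted_num_radius (1 / 2) A = num_radius A"
    by (simp add: weighted_num_radius_def)
  \<comment> \<open>The factor 1/2 is split off to cancel the one in front of
    \<open>weighted_num_radius\<close>; 1/sqrt 2 is the constant of the claim.\<close>
  have "sqrt ((1 / 2) ^ 3) = 1 / 2 * (1 / sqrt 2)"
    by (rule real_sqrt_unique) (simp_all add: power_mult_distrib power_divide power3_eq_cube)
  then have scale: "onorm (\<lambda>x. sqrt ((1 / 2) ^ 3) *\<^sub>R f x) = 1 / 2 * (1 / sqrt 2 * onorm f)"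
    if "bounded_linear f" for f :: "'a \<Rightarrow> 'a"
    using onorm_scaleR[OF that] by simp
  have "1 / sqrt 2 * onorm (\<lambda>x. re_part A x + im_part A x) \<le> num_radius A"
    using plus[of "1 / 2"] scale[OF bounded_linear_add[OF R I]]
    by (simp add: half scaleR_add_right)
  moreover have "1 / sqrt 2 * onorm (\<lambda>x. re_part A x - im_part A x) \<le> num_radius A"
    using minus[of "1 / 2"] scale[OF bounded_linear_sub[OF R I]]
    by (simp add: half scaleR_diff_right)
  moreover have "num_radius A \<le> sqrt (onorm (\<lambda>x. re_part A (re_part A x) + im_part A (im_part A x)))"
  proof -
    let ?S = "\<lambda>x. re_part A (re_part A x) + im_part A (im_part A x)"
    have "bounded_linear ?S"
      using bounded_linear_sum_squares[OF assms, of 1 1] by simp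
    then have "onorm (\<lambda>x. (1 / 2)\<^sup>2 *\<^sub>R ?S x) = (1 / 2)\<^sup>2 * onorm ?S"
      using onorm_scaleR[of ?S "(1 / 2)\<^sup>2"] by simp
    \<comment> \<open>Both weights equal (1/2)^2 here, so the square root again yields a factor 1/2
      that cancels.\<close>
    then have "sqrt (onorm (\<lambda>x. (1 / 2)\<^sup>2 *\<^sub>R ?S x)) = 1 / 2 * sqrt (onorm ?S)"
      by (simp add: real_sqrt_mult real_sqrt_divide)
    then show ?thesis
      using weighted_le_onorm_squares[OF assms, of "1 / 2"] by (simp add: half scaleR_add_right)
  qed
  ultimately show ?thesis
    using plus minus weighted_le_onorm_squares[OF assms] by blast
qed

end
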